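(* Let $\mathcal{A}$, $\mathcal{M}$, $\mathcal{N}$ be Boolean tensors of sizes $I_1\times\cdots\times I_M\times J_1\times\cdots\times J_N$, $I_1\times\cdots\times I_M\times I_1\times\cdots\times I_M$ and $J_1\times\cdots\times J_N\times J_1\times\cdots\times J_N$ respectively, with $\mathfrak{R}(\mathcal{A})=\mathfrak{R}(\mathcal{A}*_N\mathcal{N})$ and $\mathfrak{R}(\mathcal{A}^T)=\mathfrak{R}(\mathcal{A}^T*_M\mathcal{M}^T)$. If a weighted Moore-Penrose inverse $\mathcal{A}^{\dagger}_{\mathcal{M},\mathcal{N}}$ exists, then (a) $\mathcal{A}*_N\mathcal{N}^T*_N\mathcal{A}^T=\mathcal{A}*_N\mathcal{N}*_N\mathcal{A}^T$; (b) $\mathcal{A}^T*_M\mathcal{M}^T*_M\mathcal{A}=\mathcal{A}^T*_M\mathcal{M}*_M\mathcal{A}$; (c) $\mathcal{A}^{\dagger}_{\mathcal{M},\mathcal{N}}$ is unique.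
   Context: A Boolean tensor is an array with entries in $\{0,1\}$; entries are added and multiplied by the rules of the binary Boolean algebra ($1+1=1$, otherwise as usual). For $\mathcal{A}$ of size $I_1\times\cdots\times I_M\times J_1\times\cdots\times J_N$ and $\mathcal{B}$ of size $J_1\times\cdots\times J_N\times K_1\times\cdots\times K_L$, the Einstein product $\mathcal{A}*_N\mathcal{B}$ has entries $\sum_{j_1,\dots,j_N}a_{i_1\ldots i_Mj_1\ldots j_N}b_{j_1\ldots j_Nk_1\ldots k_L}$ (Boolean sum; the $k$-indices may be absent); the subscript of $*$ is the number of contracted indices (the integers $M,N$ are unrelated to the tensors $\mathcal{M},\mathcal{N}$). The transpose is $(\mathcal{A}^T)_{j_1\ldots j_Ni_1\ldots i_M}=a_{i_1\ldots i_Mj_1\ldots j_N}$. The range is $\mathfrak{R}(\mathcal{A})=\{\mathcal{A}*_N\mathcal{X}:\mathcal{X}\text{ a Boolean tensor of size }J_1\times\cdots\times J_N\}$. A weighted Moore-Penrose inverse $\mathcal{A}^{\dagger}_{\mathcal{M},\mathcal{N}}$ is a Boolean tensor $\mathcal{Z}$ of size $J_1\times\cdots\times J_N\times I_1\times\cdots\times I_M$ with (1) $\mathcal{A}*_N\mathcal{Z}*_M\mathcal{A}=\mathcal{A}$, (2) $\mathcal{Z}*_M\mathcal{A}*_N\mathcal{Z}=\mathcal{Z}$, (3) $(\mathcal{M}*_M\mathcal{A}*_N\mathcal{Z})^T=\mathcal{M}*_M\mathcal{A}*_N\mathcal{Z}$, (4) $(\mathcal{Z}*_M\mathcal{A}*_N\mathcal{N})^T=\mathcal{Z}*_M\mathcal{A}*_N\mathcal{N}$.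 *)

theory Defs
  imports Main
begin

text \<open>
  The binary Boolean algebra is the type \<open>bool\<close> made into a commutative semiring with \<open>1 + 1 = 1\<close>,
  so that \<open>sum\<close> over a finite set is the Boolean sum.
\<close>

instantiation bool :: comm_semiring_1
begin

definition zero_bool :: bool where "0 = False"
definition one_bool :: bool where "1 = True"
definition plus_bool :: "bool \<Rightarrow> bool \<Rightarrow> bool" where "a + b = (a \<or> b)"
definition times_bool :: "bool \<Rightarrow> bool \<Rightarrow> bool" where "a * b = (a \<and> b)"

instance
  by standard (auto simp: zero_bool_def one_bool_def plus_bool_def times_bool_def)

end

text \<open>
  A multi-index into an array of size \<open>ds = [d\<^sub>1, \<dots>, d\<^sub>n]\<close> is a list of length \<open>n\<close>,
  with 0-based entries.
\<close>

definition indices :: "nat list \<Rightarrow> nat list set" where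
  "indices ds = {is. list_all2 (<) is ds}"

lemma finite_indices [simp]: "finite (indices ds)"
proof (rule finite_subset)
  have "x < sum_list ds" if "list_all2 (<) is ds" "x \<in> set is" for x "is"
    using that by (induction rule: list_all2_induct) auto
  then show "indices ds \<subseteq> {is. set is \<subseteq> {..<sum_list ds} \<and> length is = length ds}"
    by (auto simp: indices_def list_all2_lengthD)
  show "finite {is. set is \<subseteq> {..<sum_list ds} \<and> length is = length ds}"
    by (rule finite_lists_length_eq) simp
qed

text \<open>
  A tensor carries its size; entries outside the size are fixed to \<open>0\<close>, so that equality of tensors
  means equal size and equal entries.
\<close>

typedef btensor =
  "{(ds :: nat list, f :: nat list \<Rightarrow> bool). \<forall>is. is \<notin> indices ds \<longrightarrow> f is = 0}"
  by (rule exI[of _ "([], \<lambda>_. 0)"]) simp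

definition dims :: "btensor \<Rightarrow> nat list" where
  "dims A = fst (Rep_btensor A)"

definition entry :: "btensor \<Rightarrow> nat list \<Rightarrow> bool" where
  "entry A = snd (Rep_btensor A)"

definition mk_btensor :: "nat list \<Rightarrow> (nat list \<Rightarrow> bool) \<Rightarrow> btensor" where
  "mk_btensor ds f = Abs_btensor (ds, \<lambda>is. if is \<in> indices ds then f is else 0)"

definition btensors :: "nat list \<Rightarrow> btensor set" where
  "btensors ds = {A. dims A = ds}"

lemma Rep_mk_btensor:
  "Rep_btensor (mk_btensor ds f) = (ds, \<lambda>is. if is \<in> indices ds then f is else 0)"
  unfolding mk_btensor_def by (rule Abs_btensor_inverse) simp

lemma dims_mk_btensor [simp]: "dims (mk_btensor ds f) = ds"
  by (simp add: dims_def Rep_mk_btensor)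

lemma entry_mk_btensor [simp]:
  "entry (mk_btensor ds f) is = (if is \<in> indices ds then f is else 0)"
  by (simp add: entry_def Rep_mk_btensor)

lemma btensor_eqI:
  assumes "dims A = dims B" and "\<And>is. is \<in> indices (dims A) \<Longrightarrow> entry A is = entry B is"
  shows "A = B"
proof -
  obtain a f b g where R: "Rep_btensor A = (a, f)" "Rep_btensor B = (b, g)"
    by fastforce
  have "f is = g is" for "is"
    using assms Rep_btensor[of A] Rep_btensor[of B]
    by (cases "is \<in> indices a") (auto simp: R dims_def entry_def)
  then have "Rep_btensor A = Rep_btensor B"
    using assms(1) by (auto simp: R dims_def)
  then show ?thesis
    by (simp add: Rep_btensor_inject)
qed

text \<open>
  In \<open>A \<star>\<^bsub>n\<^esub> B\<close> the last \<open>n\<close> indices of \<open>A\<close> are contracted with the first \<open>n\<close> indices of \<open>B\<close>;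
  this is meaningful when the corresponding sizes agree.
\<close>

definition einstein_prod :: "btensor \<Rightarrow> nat \<Rightarrow> btensor \<Rightarrow> btensor"
    ("_ \<star>\<^bsub>_\<^esub> _" [70, 0, 71] 70) where
  "A \<star>\<^bsub>n\<^esub> B =
    (let m = length (dims A) - n in
     mk_btensor (take m (dims A) @ drop n (dims B))
       (\<lambda>is. \<Sum>js \<in> indices (drop m (dims A)).
          entry A (take m is @ js) * entry B (js @ drop m is)))"

text \<open>
  The transpose depends on how the indices are split into two groups: \<open>btranspose m A\<close> swaps the first
  \<open>m\<close> indices of \<open>A\<close> with the remaining ones.
\<close>

definition btranspose :: "nat \<Rightarrow> btensor \<Rightarrow> btensor" where
  "btranspose m A =
    (let n = length (dims A) - m in
     mk_btensor (drop m (dims A) @ take m (dims A))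
       (\<lambda>js. entry A (drop n js @ take n js)))"

definition brange :: "nat \<Rightarrow> btensor \<Rightarrow> btensor set" where
  "brange n A = {A \<star>\<^bsub>n\<^esub> X |X. X \<in> btensors (drop (length (dims A) - n) (dims A))}"

text \<open>
  \<open>Z\<close> is a weighted Moore-Penrose inverse of \<open>A\<close> with weights \<open>P\<close> and \<open>Q\<close>, where \<open>A\<close> has \<open>m + n\<close> indices
  split into the first \<open>m\<close> and the last \<open>n\<close>.
\<close>

definition weighted_MP_inverse ::
    "nat \<Rightarrow> nat \<Rightarrow> btensor \<Rightarrow> btensor \<Rightarrow> btensor \<Rightarrow> btensor \<Rightarrow> bool" where
  "weighted_MP_inverse m n P Q A Z \<longleftrightarrow>
     Z \<in> btensors (drop m (dims A) @ take m (dims A)) \<and>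
     A \<star>\<^bsub>n\<^esub> Z \<star>\<^bsub>m\<^esub> A = A \<and>
     Z \<star>\<^bsub>m\<^esub> A \<star>\<^bsub>n\<^esub> Z = Z \<and>
     btranspose m (P \<star>\<^bsub>m\<^esub> A \<star>\<^bsub>n\<^esub> Z) = P \<star>\<^bsub>m\<^esub> A \<star>\<^bsub>n\<^esub> Z \<and>
     btranspose n (Z \<star>\<^bsub>m\<^esub> A \<star>\<^bsub>n\<^esub> Q) = Z \<star>\<^bsub>m\<^esub> A \<star>\<^bsub>n\<^esub> Q"

end

theory Submission imports Defs begin

text \<open>
  Once its indices are split into two groups, a Boolean tensor is a Boolean matrix, that is, a binary
  relation between multi-indices. Under this unfolding the Einstein product becomes relational
  composition (\<open>unfold_einstein_prod\<close>) and the transpose becomes the converse relation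
  (\<open>unfold_btranspose\<close>), so associativity and the reversal law for transposes come for free. The
  inclusion of one range in another says that each column of the first matrix is a combination of
  columns of the second; collecting the coefficients gives a factorisation
  (\<open>unfold_factor_of_brange_subset\<close>).

  The rest is algebra of relations. If \<open>Z\<close> is an inverse of \<open>A\<close> with weights \<open>P\<close>, \<open>Q\<close>, then
  \<open>Q\<^sup>T A\<^sup>T Z\<^sup>T = Z A Q\<close>. Hence
  \<open>A Q\<^sup>T A\<^sup>T = A Q\<^sup>T A\<^sup>T Z\<^sup>T A\<^sup>T = A Z A Q A\<^sup>T = A Q A\<^sup>T\<close>,
  which is (a). For a second inverse \<open>W\<close>, writing \<open>A = A W A\<close> in \<open>Q\<^sup>T A\<^sup>T Z\<^sup>T\<close> and using (a) gives
  \<open>Z A Q = Q\<^sup>T A\<^sup>T W\<^sup>T A\<^sup>T Z\<^sup>T = W A Q A\<^sup>T Z\<^sup>T = W A Q\<^sup>T A\<^sup>T Z\<^sup>T = W A Z A Q = W A Q\<close>.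
  The first range hypothesis yields \<open>A = A Q X\<close>, which cancels \<open>Q\<close> and leaves \<open>Z A = W A\<close>.
  Converses carry inverses of \<open>A\<close> to inverses of \<open>A\<^sup>T\<close> with the weights transposed and exchanged
  (\<open>rel_MP_inverse_converse\<close>), so the same arguments give (b) and, from the second range hypothesis,
  \<open>A Z = A W\<close>. Finally \<open>Z = Z A Z = W A Z = W A W = W\<close>.
\<close>

section \<open>Weighted Moore-Penrose inverses of relations\<close>

definition rel_MP_inverse ::
    "('a \<times> 'a) set \<Rightarrow> ('b \<times> 'b) set \<Rightarrow> ('a \<times> 'b) set \<Rightarrow> ('b \<times> 'a) set \<Rightarrow> bool" where
  "rel_MP_inverse P Q A Z \<longleftrightarrow>
     A O Z O A = A \<and> Z O A O Z = Z \<and>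
     (P O A O Z)\<inverse> = P O A O Z \<and> (Z O A O Q)\<inverse> = Z O A O Q"

text \<open>Taking converses exchanges the two symmetry conditions, and with them the two weights.\<close>

lemma rel_MP_inverse_converse:
  assumes "rel_MP_inverse P Q A Z"
  shows "rel_MP_inverse (Q\<inverse>) (P\<inverse>) (A\<inverse>) (Z\<inverse>)"
proof -
  have "A\<inverse> O Z\<inverse> O A\<inverse> = (A O Z O A)\<inverse>" "Z\<inverse> O A\<inverse> O Z\<inverse> = (Z O A O Z)\<inverse>"
    "Q\<inverse> O A\<inverse> O Z\<inverse> = (Z O A O Q)\<inverse>" "Z\<inverse> O A\<inverse> O P\<inverse> = (P O A O Z)\<inverse>"
    by (simp_all add: converse_relcomp O_assoc)
  with assms show ?thesis
    unfolding rel_MP_inverse_def by metis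
qed

text \<open>
  Expanding \<open>A\<inverse>\<close> as \<open>A\<inverse> Z\<inverse> A\<inverse>\<close> puts the weight inside \<open>Q\<inverse> A\<inverse> Z\<inverse>\<close>, the converse
  of the symmetric relation \<open>Z A Q\<close>.
\<close>

lemma rel_MP_inverse_weight_symmetric:
  assumes "rel_MP_inverse P Q A Z"
  shows "A O Q\<inverse> O A\<inverse> = A O Q O A\<inverse>"
proof -
  have AZA: "A O Z O A = A" and sym: "(Z O A O Q)\<inverse> = Z O A O Q"
    using assms by (auto simp: rel_MP_inverse_def)
  have "A O Q\<inverse> O A\<inverse> = A O Q\<inverse> O (A O Z O A)\<inverse>"
    by (simp only: AZA)
  also have "\<dots> = A O (Z O A O Q)\<inverse> O A\<inverse>"
    by (simp add: converse_relcomp O_assoc)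
  also have "\<dots> = (A O Z O A) O Q O A\<inverse>"
    by (simp only: sym O_assoc)
  finally show ?thesis
    by (simp only: AZA)
qed

text \<open>
  The factorisation hypothesis is what the equality of the ranges of \<open>A\<close> and \<open>A Q\<close> provides: it
  cancels the weight in \<open>Z A Q = W A Q\<close>.
\<close>

lemma rel_MP_inverse_left_factor_unique:
  assumes Z: "rel_MP_inverse P Q A Z" and W: "rel_MP_inverse P Q A W"
    and X: "A = A O Q O X"
  shows "Z O A = W O A"
proof -
  have AZA: "A O Z O A = A" and symZ: "(Z O A O Q)\<inverse> = Z O A O Q"
    using Z by (auto simp: rel_MP_inverse_def)
  have AWA: "A O W O A = A" and symW: "(W O A O Q)\<inverse> = W O A O Q"
    using W by (auto simp: rel_MP_inverse_def)
  have "Z O A O Q = (Z O (A O W O A) O Q)\<inverse>"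
    by (simp only: AWA symZ)
  also have "\<dots> = (W O A O Q)\<inverse> O A\<inverse> O Z\<inverse>"
    by (simp add: converse_relcomp O_assoc)
  also have "\<dots> = W O (A O Q O A\<inverse>) O Z\<inverse>"
    by (simp only: symW O_assoc)
  also have "\<dots> = W O (A O Q\<inverse> O A\<inverse>) O Z\<inverse>"
    by (simp only: rel_MP_inverse_weight_symmetric[OF Z])
  also have "\<dots> = W O A O (Z O A O Q)\<inverse>"
    by (simp add: converse_relcomp O_assoc)
  also have "\<dots> = W O (A O Z O A) O Q"
    by (simp only: symZ O_assoc)
  finally have ZAQ: "Z O A O Q = W O A O Q"
    by (simp only: AZA)
  have "Z O A = (Z O A O Q) O X"
    by (subst X) (simp only: O_assoc)
  also have "\<dots> = W O A O Q O X"
    by (simp only: ZAQ O_assoc)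
  finally show ?thesis
    by (simp only: X[symmetric])
qed

text \<open>
  The two factorisations make the outer factors of \<open>Z A Z\<close> replaceable by \<open>W\<close>: the first on the left,
  the second, through converses, on the right.
\<close>

lemma rel_MP_inverse_unique:
  assumes Z: "rel_MP_inverse P Q A Z" and W: "rel_MP_inverse P Q A W"
    and X: "A = A O Q O X" and Y: "A\<inverse> = A\<inverse> O P\<inverse> O Y"
  shows "Z = W"
proof -
  have left: "Z O A = W O A"
    using rel_MP_inverse_left_factor_unique[OF Z W X] .
  have "Z\<inverse> O A\<inverse> = W\<inverse> O A\<inverse>"
    using rel_MP_inverse_left_factor_unique
      [OF rel_MP_inverse_converse[OF Z] rel_MP_inverse_converse[OF W] Y] .
  then have right: "A O Z = A O W"
    by (metis converse_relcomp converse_converse)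
  have "Z = (Z O A) O Z"
    using Z by (simp add: rel_MP_inverse_def O_assoc)
  also have "\<dots> = W O A O W"
    by (simp only: left right O_assoc)
  also have "\<dots> = W"
    using W by (simp add: rel_MP_inverse_def)
  finally show ?thesis .
qed

section \<open>Unfolding tensors to relations\<close>

text \<open>
  The split of a concatenated multi-index into rows and columns is ambiguous until the number of row
  indices is fixed, which the condition on the length does.
\<close>

definition unfold_btensor :: "nat \<Rightarrow> btensor \<Rightarrow> (nat list \<times> nat list) set" where
  "unfold_btensor m A = {(is, js). length is = m \<and> entry A (is @ js)}"

lemma indices_append_iff:
  assumes "length is = length ds"
  shows "is @ js \<in> indices (ds @ es) \<longleftrightarrow> is \<in> indices ds \<and> js \<in> indices es"
  using assms by (simp add: indices_def list_all2_append)

lemma length_indices: "is \<in> indices ds \<Longrightarrow> length is = length ds"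
  by (auto simp: indices_def list_all2_lengthD)

lemma entry_in_indices: "entry A is \<Longrightarrow> is \<in> indices (dims A)"
  using Rep_btensor[of A] by (auto simp: entry_def dims_def zero_bool_def)

text \<open>Entries outside the size of a tensor vanish, so membership forces both multi-indices into range.\<close>

lemma mem_unfold_btensor_iff:
  assumes "dims A = Is @ Js" "length Is = m"
  shows "(is, js) \<in> unfold_btensor m A \<longleftrightarrow>
    is \<in> indices Is \<and> js \<in> indices Js \<and> entry A (is @ js)"
proof -
  have "is \<in> indices Is \<and> js \<in> indices Js" if "length is = length Is" "entry A (is @ js)"
    using entry_in_indices[OF that(2)] assms(1) that(1) by (simp add: indices_append_iff)
  then show ?thesis
    using assms(2) by (auto simp: unfold_btensor_def length_indices)
qed

lemma unfold_btensor_inject: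
  assumes "dims A = Is @ Js" "dims B = Is @ Js"
    and eq: "unfold_btensor (length Is) A = unfold_btensor (length Is) B"
  shows "A = B"
proof (rule btensor_eqI)
  fix "is" assume "is \<in> indices (dims A)"
  then have "length (take (length Is) is) = length Is"
    using assms(1) by (simp add: length_indices)
  then have "entry C is \<longleftrightarrow>
      (take (length Is) is, drop (length Is) is) \<in> unfold_btensor (length Is) C" for C
    by (simp add: unfold_btensor_def)
  then show "entry A is = entry B is"
    using eq by simp
qed (use assms in simp)

lemma sum_bool_iff: "finite S \<Longrightarrow> (\<Sum>x\<in>S. f x) \<longleftrightarrow> (\<exists>x\<in>S. f x)" for f :: "'a \<Rightarrow> bool"
  by (induction S rule: finite_induct) (auto simp: zero_bool_def plus_bool_def)

lemma dims_einstein_prod: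
  assumes "dims A = Is @ Js" "dims B = Js @ Ks" "length Js = n"
  shows "dims (A \<star>\<^bsub>n\<^esub> B) = Is @ Ks"
  using assms by (auto simp: einstein_prod_def Let_def)

lemma unfold_einstein_prod:
  assumes A: "dims A = Is @ Js" and B: "dims B = Js @ Ks"
    and "length Is = m" "length Js = n"
  shows "unfold_btensor m (A \<star>\<^bsub>n\<^esub> B) = unfold_btensor m A O unfold_btensor n B"
proof -
  have "(is, ks) \<in> unfold_btensor m (A \<star>\<^bsub>n\<^esub> B) \<longleftrightarrow>
      (is, ks) \<in> unfold_btensor m A O unfold_btensor n B" (is "?L \<longleftrightarrow> ?R") for "is" ks
  proof -
    have AB: "dims (A \<star>\<^bsub>n\<^esub> B) = Is @ Ks"
      using dims_einstein_prod[OF A B] assms(4) .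
    have "?L \<longleftrightarrow> is \<in> indices Is \<and> ks \<in> indices Ks \<and> entry (A \<star>\<^bsub>n\<^esub> B) (is @ ks)"
      by (rule mem_unfold_btensor_iff[OF AB assms(3)])
    also have "\<dots> \<longleftrightarrow> is \<in> indices Is \<and> ks \<in> indices Ks \<and>
        (\<exists>js\<in>indices Js. entry A (is @ js) \<and> entry B (js @ ks))"
      using assms
      by (auto simp: einstein_prod_def Let_def sum_bool_iff times_bool_def
          indices_append_iff length_indices)
    also have "\<dots> \<longleftrightarrow> ?R"
      unfolding relcomp_unfold
      by (auto simp: mem_unfold_btensor_iff[OF A assms(3)] mem_unfold_btensor_iff[OF B assms(4)])
    finally show ?thesis .
  qed
  then show ?thesis
    by (simp add: set_eq_iff)
qed

text \<open>
  The equations that define an inverse, and both sides of (a) and (b), are products of three factors.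
  On tensors these associate to the left, on relations to the right.
\<close>

lemma unfold_einstein_prod3:
  assumes "dims A = Is @ Js" "dims B = Js @ Ks" "dims C = Ks @ Ls"
    and "length Is = m" "length Js = n" "length Ks = l"
  shows "dims (A \<star>\<^bsub>n\<^esub> B \<star>\<^bsub>l\<^esub> C) = Is @ Ls"
    and "unfold_btensor m (A \<star>\<^bsub>n\<^esub> B \<star>\<^bsub>l\<^esub> C) =
      unfold_btensor m A O unfold_btensor n B O unfold_btensor l C"
proof -
  have AB: "dims (A \<star>\<^bsub>n\<^esub> B) = Is @ Ks"
    using assms by (intro dims_einstein_prod)
  show "dims (A \<star>\<^bsub>n\<^esub> B \<star>\<^bsub>l\<^esub> C) = Is @ Ls"
    using AB assms by (intro dims_einstein_prod)
  show "unfold_btensor m (A \<star>\<^bsub>n\<^esub> B \<star>\<^bsub>l\<^esub> C) =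
      unfold_btensor m A O unfold_btensor n B O unfold_btensor l C"
    using unfold_einstein_prod[OF AB assms(3,4,6)] unfold_einstein_prod[OF assms(1,2,4,5)]
    by (simp add: O_assoc)
qed

lemma dims_btranspose:
  assumes "dims A = Is @ Js" "length Is = m"
  shows "dims (btranspose m A) = Js @ Is"
  using assms by (simp add: btranspose_def Let_def)

lemma unfold_btranspose:
  assumes A: "dims A = Is @ Js" and "length Is = m" "length Js = n"
  shows "unfold_btensor n (btranspose m A) = (unfold_btensor m A)\<inverse>"
proof -
  have "(js, is) \<in> unfold_btensor n (btranspose m A) \<longleftrightarrow> (is, js) \<in> unfold_btensor m A"
      (is "?L \<longleftrightarrow> ?R") for "is" js
  proof -
    have "?L \<longleftrightarrow> js \<in> indices Js \<and> is \<in> indices Is \<and> entry (btranspose m A) (js @ is)"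
      using dims_btranspose[OF A assms(2)] assms(3) by (rule mem_unfold_btensor_iff)
    also have "\<dots> \<longleftrightarrow> is \<in> indices Is \<and> js \<in> indices Js \<and> entry A (is @ js)"
      using assms
      by (auto simp: btranspose_def Let_def indices_append_iff length_indices)
    also have "\<dots> \<longleftrightarrow> ?R"
      using mem_unfold_btensor_iff[OF A assms(2)] by blast
    finally show ?thesis .
  qed
  then show ?thesis
    by auto
qed

text \<open>
  Multiplying \<open>A\<close> by the unit vector at \<open>js\<close> selects the column of \<open>A\<close> at \<open>js\<close>. By the inclusion of
  ranges this column is \<open>B\<close> times some vector, and these vectors are the columns of the cofactor.
\<close>

lemma unfold_factor_of_brange_subset:
  assumes A: "dims A = Is @ Js" and B: "dims B = Is @ Ks"
    and len: "length Is = m" "length Js = n" "length Ks = l"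
    and sub: "brange n A \<subseteq> brange l B"
  shows "\<exists>X. unfold_btensor m A = unfold_btensor m B O X"
proof -
  \<comment> \<open>the unit vectors; a vector unfolds to a relation whose only column index is \<open>[]\<close>\<close>
  define E where "E js = mk_btensor Js (\<lambda>ks. ks = js)" for js
  have "\<exists>V. dims V = Ks \<and> A \<star>\<^bsub>n\<^esub> E js = B \<star>\<^bsub>l\<^esub> V" for js
  proof -
    have "A \<star>\<^bsub>n\<^esub> E js \<in> brange n A"
      using A len by (auto simp: brange_def btensors_def E_def)
    with sub show ?thesis
      using B len by (auto simp: brange_def btensors_def)
  qed
  then obtain V where V: "dims (V js) = Ks" "A \<star>\<^bsub>n\<^esub> E js = B \<star>\<^bsub>l\<^esub> V js" for js
    by metis
  have column: "(is, js) \<in> unfold_btensor m A \<longleftrightarrow>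
      (is, []) \<in> unfold_btensor m B O unfold_btensor l (V js)"
    if js: "js \<in> indices Js" for "is" js
  proof -
    have "unfold_btensor n (E js) = {(js, [])}"
      using js len
      by (auto simp: unfold_btensor_def E_def zero_bool_def length_indices split: if_splits)
        (auto simp: indices_def dest: list_all2_lengthD)
    then have "(is, js) \<in> unfold_btensor m A \<longleftrightarrow>
        (is, []) \<in> unfold_btensor m A O unfold_btensor n (E js)"
      by auto
    also have "unfold_btensor m A O unfold_btensor n (E js) = unfold_btensor m (A \<star>\<^bsub>n\<^esub> E js)"
      by (rule unfold_einstein_prod[symmetric, where Ks = "[]"]) (use A len in \<open>simp_all add: E_def\<close>)
    also have "\<dots> = unfold_btensor m B O unfold_btensor l (V js)"
      unfolding V(2) by (rule unfold_einstein_prod[where Ks = "[]"]) (use B V(1) len in simp_all)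
    finally show ?thesis .
  qed
  define X where "X = {(ks, js). js \<in> indices Js \<and> (ks, []) \<in> unfold_btensor l (V js)}"
  have "unfold_btensor m A = unfold_btensor m B O X"
    using column mem_unfold_btensor_iff[OF A len(1)]
      mem_unfold_btensor_iff[OF B len(1)] unfolding X_def relcomp_unfold by blast
  then show ?thesis ..
qed

section \<open>Weighted Moore-Penrose inverses of tensors\<close>

lemma unfold_weighted_MP_inverse:
  assumes A: "dims A = Is @ Js" and P: "dims P = Is @ Is" and Q: "dims Q = Js @ Js"
    and len: "length Is = m" "length Js = n"
    and inv: "weighted_MP_inverse m n P Q A Z"
  shows "dims Z = Js @ Is"
    and "rel_MP_inverse (unfold_btensor m P) (unfold_btensor n Q)
           (unfold_btensor m A) (unfold_btensor n Z)"
proof -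
  show Z: "dims Z = Js @ Is"
    using inv A len by (simp add: weighted_MP_inverse_def btensors_def)
  note AZA = unfold_einstein_prod3[OF A Z A len len(1)]
  note ZAZ = unfold_einstein_prod3[OF Z A Z len(2) len]
  note PAZ = unfold_einstein_prod3[OF P A Z len(1) len]
  note ZAQ = unfold_einstein_prod3[OF Z A Q len(2) len]
  show "rel_MP_inverse (unfold_btensor m P) (unfold_btensor n Q)
      (unfold_btensor m A) (unfold_btensor n Z)"
    unfolding rel_MP_inverse_def
  proof (intro conjI)
    show "unfold_btensor m A O unfold_btensor n Z O unfold_btensor m A = unfold_btensor m A"
      using AZA(2) inv by (simp add: weighted_MP_inverse_def)
    show "unfold_btensor n Z O unfold_btensor m A O unfold_btensor n Z = unfold_btensor n Z"
      using ZAZ(2) inv by (simp add: weighted_MP_inverse_def)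
    show "(unfold_btensor m P O unfold_btensor m A O unfold_btensor n Z)\<inverse> =
        unfold_btensor m P O unfold_btensor m A O unfold_btensor n Z"
      using unfold_btranspose[OF PAZ(1) len(1) len(1)] PAZ(2) inv
      by (simp add: weighted_MP_inverse_def)
    show "(unfold_btensor n Z O unfold_btensor m A O unfold_btensor n Q)\<inverse> =
        unfold_btensor n Z O unfold_btensor m A O unfold_btensor n Q"
      using unfold_btranspose[OF ZAQ(1) len(2) len(2)] ZAQ(2) inv
      by (simp add: weighted_MP_inverse_def)
  qed
qed

theorem theorem3p31:
  fixes M N :: nat and Is Js :: "nat list" and \<A> \<M> \<N> :: btensor
  assumes "length Is = M" and "length Js = N"
    and "\<A> \<in> btensors (Is @ Js)"
    and "\<M> \<in> btensors (Is @ Is)"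
    and "\<N> \<in> btensors (Js @ Js)"
    and "brange N \<A> = brange N (\<A> \<star>\<^bsub>N\<^esub> \<N>)"
    and "brange M (btranspose M \<A>) = brange M (btranspose M \<A> \<star>\<^bsub>M\<^esub> btranspose M \<M>)"
    and "\<exists>\<Z>. weighted_MP_inverse M N \<M> \<N> \<A> \<Z>"
  shows "\<A> \<star>\<^bsub>N\<^esub> btranspose N \<N> \<star>\<^bsub>N\<^esub> btranspose M \<A> = \<A> \<star>\<^bsub>N\<^esub> \<N> \<star>\<^bsub>N\<^esub> btranspose M \<A> \<and>
    btranspose M \<A> \<star>\<^bsub>M\<^esub> btranspose M \<M> \<star>\<^bsub>M\<^esub> \<A> = btranspose M \<A> \<star>\<^bsub>M\<^esub> \<M> \<star>\<^bsub>M\<^esub> \<A> \<and>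
    (\<exists>!\<Z>. weighted_MP_inverse M N \<M> \<N> \<A> \<Z>)"
proof -
  note len = assms(1,2)
  have A: "dims \<A> = Is @ Js" and P: "dims \<M> = Is @ Is" and Q: "dims \<N> = Js @ Js"
    using assms(3-5) by (simp_all add: btensors_def)
  note AT = dims_btranspose[OF A len(1)] and PT = dims_btranspose[OF P len(1)]
    and QT = dims_btranspose[OF Q len(2)]
  let ?A = "unfold_btensor M \<A>" and ?P = "unfold_btensor M \<M>" and ?Q = "unfold_btensor N \<N>"
  have conv: "unfold_btensor N (btranspose M \<A>) = ?A\<inverse>"
    "unfold_btensor M (btranspose M \<M>) = ?P\<inverse>" "unfold_btensor N (btranspose N \<N>) = ?Q\<inverse>"
    using unfold_btranspose[OF A len] unfold_btranspose[OF P len(1) len(1)]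
      unfold_btranspose[OF Q len(2) len(2)] by simp_all
  note inverse = unfold_weighted_MP_inverse[OF A P Q len]
  obtain \<Z> where Z: "weighted_MP_inverse M N \<M> \<N> \<A> \<Z>"
    using assms(8) by blast
  note relZ = inverse(2)[OF Z]

  have a: "\<A> \<star>\<^bsub>N\<^esub> btranspose N \<N> \<star>\<^bsub>N\<^esub> btranspose M \<A> = \<A> \<star>\<^bsub>N\<^esub> \<N> \<star>\<^bsub>N\<^esub> btranspose M \<A>"
  proof (rule unfold_btensor_inject[where Is = Is and Js = Is])
    note l = unfold_einstein_prod3[OF A QT AT len len(2)]
      and r = unfold_einstein_prod3[OF A Q AT len len(2)]
    show "dims (\<A> \<star>\<^bsub>N\<^esub> btranspose N \<N> \<star>\<^bsub>N\<^esub> btranspose M \<A>) = Is @ Is"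
      "dims (\<A> \<star>\<^bsub>N\<^esub> \<N> \<star>\<^bsub>N\<^esub> btranspose M \<A>) = Is @ Is"
      using l(1) r(1) .
    show "unfold_btensor (length Is) (\<A> \<star>\<^bsub>N\<^esub> btranspose N \<N> \<star>\<^bsub>N\<^esub> btranspose M \<A>) =
        unfold_btensor (length Is) (\<A> \<star>\<^bsub>N\<^esub> \<N> \<star>\<^bsub>N\<^esub> btranspose M \<A>)"
      unfolding len(1) l(2) r(2) conv by (rule rel_MP_inverse_weight_symmetric[OF relZ])
  qed

  \<comment> \<open>the inverse of the converse relation has \<open>?P\<inverse>\<close> as its right weight\<close>
  have b: "btranspose M \<A> \<star>\<^bsub>M\<^esub> btranspose M \<M> \<star>\<^bsub>M\<^esub> \<A> = btranspose M \<A> \<star>\<^bsub>M\<^esub> \<M> \<star>\<^bsub>M\<^esub> \<A>"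
  proof (rule unfold_btensor_inject[where Is = Js and Js = Js])
    note l = unfold_einstein_prod3[OF AT PT A len(2) len(1) len(1)]
      and r = unfold_einstein_prod3[OF AT P A len(2) len(1) len(1)]
    show "dims (btranspose M \<A> \<star>\<^bsub>M\<^esub> btranspose M \<M> \<star>\<^bsub>M\<^esub> \<A>) = Js @ Js"
      "dims (btranspose M \<A> \<star>\<^bsub>M\<^esub> \<M> \<star>\<^bsub>M\<^esub> \<A>) = Js @ Js"
      using l(1) r(1) .
    show "unfold_btensor (length Js) (btranspose M \<A> \<star>\<^bsub>M\<^esub> btranspose M \<M> \<star>\<^bsub>M\<^esub> \<A>) =
        unfold_btensor (length Js) (btranspose M \<A> \<star>\<^bsub>M\<^esub> \<M> \<star>\<^bsub>M\<^esub> \<A>)"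
      unfolding len(2) l(2) r(2) conv
      using rel_MP_inverse_weight_symmetric[OF rel_MP_inverse_converse[OF relZ]]
      by simp
  qed

  have AQ: "dims (\<A> \<star>\<^bsub>N\<^esub> \<N>) = Is @ Js"
    using dims_einstein_prod[OF A Q len(2)] .
  obtain X where "?A = unfold_btensor M (\<A> \<star>\<^bsub>N\<^esub> \<N>) O X"
    using unfold_factor_of_brange_subset[OF A AQ len len(2) equalityD1[OF assms(6)]] ..
  then have X: "?A = ?A O ?Q O X"
    by (simp only: unfold_einstein_prod[OF A Q len] O_assoc)
  have ATPT: "dims (btranspose M \<A> \<star>\<^bsub>M\<^esub> btranspose M \<M>) = Js @ Is"
    using dims_einstein_prod[OF AT PT len(1)] .
  obtain Y where
    "unfold_btensor N (btranspose M \<A>) =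
       unfold_btensor N (btranspose M \<A> \<star>\<^bsub>M\<^esub> btranspose M \<M>) O Y"
    using unfold_factor_of_brange_subset
      [OF AT ATPT len(2) len(1) len(1) equalityD1[OF assms(7)]] ..
  then have Y: "?A\<inverse> = ?A\<inverse> O ?P\<inverse> O Y"
    by (simp only: unfold_einstein_prod[OF AT PT len(2) len(1)] conv O_assoc)
  have "\<W> = \<Z>" if W: "weighted_MP_inverse M N \<M> \<N> \<A> \<W>" for \<W>
    using unfold_btensor_inject[OF inverse(1)[OF W] inverse(1)[OF Z]]
      rel_MP_inverse_unique[OF inverse(2)[OF W] relZ X Y] len(2) by blast
  with Z a b show ?thesis
    by blast
qed

end
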